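(* For every constant $\rho\ge 0$, the point $P=(v_2,v_6,v_1,v_3,v_5)^\top=(-\rho,0,0,0,0)^\top$ is PNS-free.
   Context: A fourth order four dimensional Hankel tensor $\mathcal{A}=(a_{i_1i_2i_3i_4})$ with generating vector $\mathbf{v}=(v_0,\ldots,v_{12})^\top\in\mathbb{R}^{13}$ is defined by $a_{i_1i_2i_3i_4}=v_{i_1+i_2+i_3+i_4-4}$ for $i_1,i_2,i_3,i_4\in\{1,2,3,4\}$. Its associated polynomial is $f(\mathbf{x})=\sum_{i_1,i_2,i_3,i_4=1}^4 v_{i_1+i_2+i_3+i_4-4}\,x_{i_1}x_{i_2}x_{i_3}x_{i_4}$, $\mathbf{x}\in\mathbb{R}^4$. $\mathcal{A}$ is PSD if $f(\mathbf{x})\ge 0$ for all $\mathbf{x}\in\mathbb{R}^4$; it is SOS if $f$ is a sum of squares of real quadratic homogeneous polynomials. Given $P=(v_2,v_6,v_1,v_3,v_5)^\top\in\mathbb{R}^5$ and $v_0\in\mathbb{R}$, $\mathcal{A}$ denotes the Hankel tensor with generating vector $(v_0,v_1,v_2,v_3,1,v_5,v_6,v_5,1,v_3,v_2,v_1,v_0)^\top$. $M_0(P)$ (respectively $N_0(P)$) denotes the smallest $v_0$ for which $\mathcal{A}$ is SOS (respectively PSD), so that $\mathcal{A}$ is SOS iff $v_0\ge M_0(P)$ and PSD iff $v_0\ge N_0(P)$. $P$ is called PNS-free if $M_0(P)$ and $N_0(P)$ exist and $M_0(P)=N_0(P)$. *)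

theory Defs
  imports "HOL-Analysis.Analysis"
begin

text \<open>Coordinates are indexed by \<^term>\<open>{1..4::nat}\<close> and read off as \<^term>\<open>(x::real^4) $ of_nat i\<close>.
  In the type 4 the numeral 4 denotes the element 0, so these are four distinct coordinates.\<close>

lemma bij_betw_of_nat_4: "bij_betw (of_nat :: nat \<Rightarrow> 4) {1..4} UNIV"
proof -
  have eq: "{1..4::nat} = {1, 2, 3, 4}" by auto
  have "card (UNIV :: 4 set) = card {1..4::nat}" by simp
  moreover have "of_nat ` {1..4::nat} = (UNIV :: 4 set)"
    unfolding eq by (simp add: UNIV_4)
  ultimately show ?thesis
    by (metis bij_betw_def eq_card_imp_inj_on finite_atLeastAtMost)
qed

type_synonym tensor = "nat \<Rightarrow> nat \<Rightarrow> nat \<Rightarrow> nat \<Rightarrow> real"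

text \<open>The generating vector is the list \<^term>\<open>v\<close> of its 13 entries \<open>v ! 0, \<dots>, v ! 12\<close>;
  only tensor entries with all indices in \<^term>\<open>{1..4::nat}\<close> are meaningful.\<close>

definition hankel_tensor :: "real list \<Rightarrow> tensor" where
  "hankel_tensor v i1 i2 i3 i4 = v ! (i1 + i2 + i3 + i4 - 4)"

definition tensor_poly :: "tensor \<Rightarrow> real^4 \<Rightarrow> real" where
  "tensor_poly A x =
    (\<Sum>i1=1..4. \<Sum>i2=1..4. \<Sum>i3=1..4. \<Sum>i4=1..4.
       A i1 i2 i3 i4 * (x $ of_nat i1) * (x $ of_nat i2) * (x $ of_nat i3) * (x $ of_nat i4))"

definition PSD :: "tensor \<Rightarrow> bool" where
  "PSD A \<longleftrightarrow> (\<forall>x. tensor_poly A x \<ge> 0)"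

text \<open>Real polynomials are identified with the functions they induce on \<open>\<real>\<^sup>4\<close>;
  the zero form counts as homogeneous quadratic.\<close>

definition quadratic_form :: "(real^4 \<Rightarrow> real) \<Rightarrow> bool" where
  "quadratic_form q \<longleftrightarrow>
    (\<exists>c :: nat \<Rightarrow> nat \<Rightarrow> real.
       \<forall>x. q x = (\<Sum>i=1..4. \<Sum>j=1..4. c i j * (x $ of_nat i) * (x $ of_nat j)))"

definition SOS :: "tensor \<Rightarrow> bool" where
  "SOS A \<longleftrightarrow>
    (\<exists>(m::nat) q. (\<forall>k<m. quadratic_form (q k)) \<and> (\<forall>x. tensor_poly A x = (\<Sum>k<m. (q k x)\<^sup>2)))"

text \<open>The parameters are ordered as \<open>P = (v2, v6, v1, v3, v5)\<close>.\<close>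

type_synonym param = "real \<times> real \<times> real \<times> real \<times> real"

fun param_tensor :: "param \<Rightarrow> real \<Rightarrow> tensor" where
  "param_tensor (v2, v6, v1, v3, v5) v0 =
     hankel_tensor [v0, v1, v2, v3, 1, v5, v6, v5, 1, v3, v2, v1, v0]"

definition has_least :: "(real \<Rightarrow> bool) \<Rightarrow> bool" where
  "has_least Q \<longleftrightarrow> (\<exists>m. Q m \<and> (\<forall>y. Q y \<longrightarrow> m \<le> y))"

text \<open>On the reals \<open>LEAST\<close> is unspecified when no minimum is attained, hence the existence
  conditions in \<open>PNS_free\<close>.\<close>

definition M0 :: "param \<Rightarrow> real" where
  "M0 P = (LEAST v0. SOS (param_tensor P v0))"

definition N0 :: "param \<Rightarrow> real" where
  "N0 P = (LEAST v0. PSD (param_tensor P v0))"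

definition PNS_free :: "param \<Rightarrow> bool" where
  "PNS_free P \<longleftrightarrow>
     has_least (\<lambda>v0. SOS (param_tensor P v0)) \<and>
     has_least (\<lambda>v0. PSD (param_tensor P v0)) \<and>
     M0 P = N0 P"

end

theory Submission
  imports Defs
begin

text \<open>Write \<open>x = (a, b, c, d)\<close>. On the points \<open>(1, t, t, 1)\<close> the form is
  \<open>2 (v\<^sub>0 + q(t))\<close> with \<open>q(t) = t^4 + 12 t^3 + 6 (1 - \<rho>) t^2 + 4 (3 - \<rho>) t\<close>, so PSD forces
  \<open>v\<^sub>0 \<ge> - min q\<close>. The minimiser is \<open>t = - T\<close>, where \<open>T\<close> is the largest root of
  \<open>T^3 - 9 T^2 + 3 T - 3 = \<rho> (3 T - 1)\<close>, and at this \<open>v\<^sub>0\<close> the form is already a sum of squares.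
  The Gram matrix is block-diagonalised by the symmetries \<open>(a, b, c, d) \<mapsto> (d, c, b, a)\<close> and
  \<open>(a, b, c, d) \<mapsto> (a, - b, c, - d)\<close>; the zeros \<open>(1, \<mp>T, - T, \<plusminus>1)\<close> reduce the two blocks
  on which they do not vanish to binary forms. The remaining free Gram entries are chosen so that
  every block becomes an explicit polynomial in \<open>T\<close> and \<open>\<tau> = \<rho> / T^2\<close>.\<close>

section \<open>The quartic form, its Gram identity and the critical discriminant\<close>

lemma sum_1_to_4: "(\<Sum>i=1..4::nat. f i) = f 1 + f 2 + f 3 + (f 4 :: 'a::comm_monoid_add)"
  by (simp add: numeral_eq_Suc ac_simps)

text \<open>The coordinates enter through equations, so that both coordinate functions and the
  numbers of a concrete point can be inserted.\<close>

lemma tensor_poly_param: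
  fixes x :: "real^4"
  assumes "a = x $ of_nat 1" "b = x $ of_nat 2" "c = x $ of_nat 3" "d = x $ of_nat 4"
  shows "tensor_poly (param_tensor (- \<rho>, 0, 0, 0, 0) v) x =
    v * (a^4 + d^4) - \<rho> * (4 * (a^3 * c + b * d^3) + 6 * (a^2 * b^2 + c^2 * d^2))
    + 12 * (a^2 * b * d + a * c * d^2) + 6 * (a^2 * c^2 + b^2 * d^2)
    + 12 * (a * b^2 * c + b * c^2 * d) + (b^4 + c^4)"
  unfolding tensor_poly_def sum_1_to_4 assms[symmetric] param_tensor.simps hankel_tensor_def
  by (simp add: eval_nat_numeral) (simp add: algebra_simps)

text \<open>The forms \<^term>\<open>u\<close> and \<^term>\<open>w\<close> vanish at the zeros of the quartic form.\<close>

lemma gram_decomposition: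
  fixes a b c d T \<tau> :: real
  assumes "T^3 - 9 * T^2 + 3 * T - 3 = \<tau> * T^2 * (3 * T - 1)"
  defines "k \<equiv> T^2 - 12 * T + 6 + 2 * \<tau> * T"
  defines "v \<equiv> T^4 - 6 * T^3 - 2 * \<tau> * T^3 + 6 * T"
  defines "X \<equiv> a^2 + d^2" and "Y \<equiv> b^2 + c^2" and "Z \<equiv> a * c + b * d"
  defines "X' \<equiv> a^2 - d^2" and "Y' \<equiv> c^2 - b^2" and "Z' \<equiv> a * c - b * d"
  defines "u \<equiv> T^2 * X - Y" and "w \<equiv> Y + T * Z"
  shows "T * (v * (a^4 + d^4) - (\<tau> * T^2) * (4 * (a^3 * c + b * d^3) + 6 * (a^2 * b^2 + c^2 * d^2))
    + 12 * (a^2 * b * d + a * c * d^2) + 6 * (a^2 * c^2 + b^2 * d^2)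
    + 12 * (a * b^2 * c + b * c^2 * d) + (b^4 + c^4)) =
    (((T - 6) / 2 - \<tau>) * u^2 + 2 * (- \<tau>) * u * w + (3 - \<tau>) * w^2)
    + 3 * (a * b + c * d + 2 * T * (a * d))^2 + 3 * (a * b - c * d)^2
    + T / 2 * (Y' + k * X' - 6 * Z')^2
    + T / 2 * ((6 * T - 36 - 2 * \<tau> * T) * Z'^2 + 2 * (6 * k - 2 * \<tau> * T^2) * Z' * X'
        + (v + 6 * T - k^2) * X'^2)" (is "?l = ?r")
proof -
  \<comment> \<open>The two sides agree only modulo the cubic relation; the defect is an explicit
    multiple of it.\<close>
  have "?l - ?r = (T^3 - 9 * T^2 + 3 * T - 3 - \<tau> * T^2 * (3 * T - 1)) * (2 * (a^2 * b^2 + c^2 * d^2))"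
    unfolding k_def v_def u_def w_def X_def Y_def Z_def X'_def Y'_def Z'_def
    by (simp add: field_simps power2_eq_square power3_eq_cube power4_eq_xxxx)
  then show ?thesis using assms(1) by simp
qed

text \<open>The constant \<open>869/100\<close> lies just below the value \<open>T \<approx> 8.696\<close> belonging to \<open>\<rho> = 0\<close>;
  the inequality already fails at \<open>T = 8.6\<close>.\<close>

lemma discriminant_bound:
  fixes T \<tau> :: real
  assumes rel: "T^3 - 9 * T^2 + 3 * T - 3 = \<tau> * T^2 * (3 * T - 1)" and T: "T \<ge> 869 / 100"
  defines "k \<equiv> T^2 - 12 * T + 6 + 2 * \<tau> * T"
  shows "(6 * k - 2 * \<tau> * T^2)^2 \<le>
    (6 * T - 36 - 2 * \<tau> * T) * (T^4 - 6 * T^3 - 2 * \<tau> * T^3 + 12 * T - k^2)" (is "?l \<le> ?r")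
proof -
  \<comment> \<open>The relation reads \<open>\<tau> = N / (T * E)\<close>. Both sides have degree
    at most 3 in \<open>\<tau>\<close>, so multiplying by \<open>E^3\<close> leaves a polynomial in
    \<open>T\<close> alone.\<close>
  define E where "E = T * (3 * T - 1)"
  define N where "N = T^3 - 9 * T^2 + 3 * T - 3"
  have E: "E > 0" unfolding E_def using T by simp
  have N: "\<tau> * T * E = N" unfolding E_def N_def rel by (simp add: power2_eq_square)
  let ?p = "64*T^10 - 600*T^9 + 472*T^8 - 429*T^7 + 19*T^6 - 6*T^5 + 66*T^4 - 90*T^3 + 9*T - 9"
  have "E^3 * (?r - ?l) = (6*T*E - 36*E - 2*(\<tau>*T*E)) * ((T^4 - 6*T^3 + 12*T) * E^2 - 2*T^2*(\<tau>*T*E)*E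
      - ((T^2 - 12*T + 6)*E + 2*(\<tau>*T*E))^2)
      - E * (6 * ((T^2 - 12*T + 6)*E + 2*(\<tau>*T*E)) - 2*T*(\<tau>*T*E))^2"
    unfolding k_def by (simp add: algebra_simps power2_eq_square power3_eq_cube power4_eq_xxxx)
  also have "\<dots> = 24 * ?p"
    unfolding N unfolding E_def N_def
    by (simp add: algebra_simps power2_eq_square power3_eq_cube eval_nat_numeral)
  also have "\<dots> \<ge> 0"
  proof -
    \<comment> \<open>This regroups \<open>?p\<close>; only the first summand is delicate.\<close>
    have "T^7 * (T * (64*T^2 - 600*T + 472) - 429) + T^5 * (19*T - 6) + T^3 * (66*T - 90) + (9*T - 9) \<ge> 0"
    proof -
      \<comment> \<open>The product is the increment of \<open>64*T^2 - 600*T\<close> from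
        \<open>869/100\<close> to \<open>T\<close>; at \<open>869/100\<close> the quadratic
        \<open>64*T^2 - 600*T + 472\<close> is about 91.03.\<close>
      have "0 \<le> (T - 869/100) * (64 * (T + 869/100) - 600)"
        using T by (intro mult_nonneg_nonneg) auto
      then have "64*T^2 - 600*T + 472 \<ge> 90" by (simp add: algebra_simps power2_eq_square)
      then have "T * (64*T^2 - 600*T + 472) \<ge> (869/100) * 90"
        using T by (intro mult_mono) auto
      then show ?thesis using T by (intro add_nonneg_nonneg mult_nonneg_nonneg) auto
    qed
    then show ?thesis by (simp add: algebra_simps eval_nat_numeral)
  qed
  finally show ?thesis using E by (simp add: zero_le_mult_iff)
qed

section \<open>Closure properties of quadratic forms and of sums of squares\<close>

lemma quadratic_form_coord_mult:
  assumes "i \<in> {1..4}" "j \<in> {1..4}"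
  shows "quadratic_form (\<lambda>x. (x $ of_nat i) * (x $ of_nat j))"
proof -
  have "(x $ of_nat i) * (x $ of_nat j) = (\<Sum>k=1..4. \<Sum>l=1..4.
      (if k = i \<and> l = j then 1 else 0) * (x $ of_nat k) * (x $ of_nat l))" for x :: "real^4"
  proof -
    have "(\<Sum>l=1..4. (if k = i \<and> l = j then 1 else 0) * (x $ of_nat k) * (x $ of_nat l))
        = (if k = i then (x $ of_nat k) * (x $ of_nat j) else 0)" for k
      using assms(2) by (auto simp: if_distrib[of "\<lambda>r. r * _"] cong: if_cong)
    then show ?thesis
      using assms(1) by simp
  qed
  then show ?thesis
    unfolding quadratic_form_def
    by (intro exI[of _ "\<lambda>k l. if k = i \<and> l = j then 1 else 0"] allI)
qed

lemma quadratic_form_add: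
  assumes "quadratic_form p" "quadratic_form q"
  shows "quadratic_form (\<lambda>x. p x + q x)"
proof -
  obtain c d where "\<And>x. p x = (\<Sum>i=1..4. \<Sum>j=1..4. c i j * (x $ of_nat i) * (x $ of_nat j))"
    and "\<And>x. q x = (\<Sum>i=1..4. \<Sum>j=1..4. d i j * (x $ of_nat i) * (x $ of_nat j))"
    using assms unfolding quadratic_form_def by blast
  then show ?thesis
    unfolding quadratic_form_def
    by (intro exI[of _ "\<lambda>i j. c i j + d i j"]) (simp add: sum.distrib algebra_simps)
qed

lemma quadratic_form_scale:
  assumes "quadratic_form p"
  shows "quadratic_form (\<lambda>x. r * p x)"
proof -
  obtain c where "\<And>x. p x = (\<Sum>i=1..4. \<Sum>j=1..4. c i j * (x $ of_nat i) * (x $ of_nat j))"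
    using assms unfolding quadratic_form_def by blast
  then show ?thesis
    unfolding quadratic_form_def
    by (intro exI[of _ "\<lambda>i j. r * c i j"]) (simp add: sum_distrib_left mult.assoc)
qed

lemma quadratic_form_diff:
  assumes "quadratic_form p" "quadratic_form q"
  shows "quadratic_form (\<lambda>x. p x - q x)"
  using quadratic_form_add[OF assms(1) quadratic_form_scale[OF assms(2), of "-1"]] by simp

text \<open>Freed from tensors, so that the summands of the Gram identity can be treated
  separately.\<close>

definition sum_of_squares :: "(real^4 \<Rightarrow> real) \<Rightarrow> bool" where
  "sum_of_squares f \<longleftrightarrow>
    (\<exists>(m::nat) q. (\<forall>k<m. quadratic_form (q k)) \<and> (\<forall>x. f x = (\<Sum>k<m. (q k x)\<^sup>2)))"

lemma SOS_iff_sum_of_squares: "SOS A \<longleftrightarrow> sum_of_squares (tensor_poly A)"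
  unfolding SOS_def sum_of_squares_def ..

lemma sum_of_squares_power2:
  assumes "quadratic_form p"
  shows "sum_of_squares (\<lambda>x. (p x)\<^sup>2)"
  unfolding sum_of_squares_def
  by (rule exI[of _ 1], rule exI[of _ "\<lambda>_. p"]) (simp add: assms)

lemma sum_of_squares_add:
  assumes "sum_of_squares f" "sum_of_squares g"
  shows "sum_of_squares (\<lambda>x. f x + g x)"
proof -
  obtain m n :: nat and p q where p: "\<And>k. k < m \<Longrightarrow> quadratic_form (p k)"
    and f: "\<And>x. f x = (\<Sum>k<m. (p k x)\<^sup>2)" and q: "\<And>k. k < n \<Longrightarrow> quadratic_form (q k)"
    and g: "\<And>x. g x = (\<Sum>k<n. (q k x)\<^sup>2)"
    using assms unfolding sum_of_squares_def by blast
  define r where "r k = (if k < m then p k else q (k - m))" for k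
  have "quadratic_form (r k)" if "k < m + n" for k
    using that p q by (simp add: r_def)
  moreover have "f x + g x = (\<Sum>k<m + n. (r k x)\<^sup>2)" for x
  proof -
    have "(\<Sum>k<m + n. (r k x)\<^sup>2) = (\<Sum>k<m. (r k x)\<^sup>2) + (\<Sum>k<n. (r (m + k) x)\<^sup>2)"
      by (induction n) (simp_all add: add.assoc)
    then show ?thesis by (simp add: r_def f g)
  qed
  ultimately show ?thesis unfolding sum_of_squares_def by blast
qed

lemma sum_of_squares_scale:
  assumes "sum_of_squares f" "r \<ge> 0"
  shows "sum_of_squares (\<lambda>x. r * f x)"
proof -
  obtain m :: nat and p where p: "\<forall>k<m. quadratic_form (p k)"
    and f: "\<And>x. f x = (\<Sum>k<m. (p k x)\<^sup>2)"
    using assms(1) unfolding sum_of_squares_def by blast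
  have "r * f x = (\<Sum>k<m. (sqrt r * p k x)\<^sup>2)" for x
    using assms(2) by (simp add: f sum_distrib_left power_mult_distrib)
  with p show ?thesis
    unfolding sum_of_squares_def
    by (intro exI[of _ m] exI[of _ "\<lambda>k x. sqrt r * p k x"]) (simp add: quadratic_form_scale)
qed

text \<open>Completing the square in \<open>p\<close> leaves a nonnegative multiple of the square of
  \<open>q\<close>.\<close>

lemma sum_of_squares_binary:
  assumes p: "quadratic_form p" and q: "quadratic_form q" and "\<alpha> > 0" and "\<beta>\<^sup>2 \<le> \<alpha> * \<gamma>"
  shows "sum_of_squares (\<lambda>x. \<alpha> * (p x)\<^sup>2 + 2 * \<beta> * p x * q x + \<gamma> * (q x)\<^sup>2)"
proof -
  have "\<alpha> * (p x)\<^sup>2 + 2 * \<beta> * p x * q x + \<gamma> * (q x)\<^sup>2 =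
      \<alpha> * (p x + \<beta> / \<alpha> * q x)\<^sup>2 + (\<gamma> - \<beta>\<^sup>2 / \<alpha>) * (q x)\<^sup>2" for x
    using \<open>\<alpha> > 0\<close> by (simp add: field_simps power2_eq_square)
  moreover have "\<gamma> - \<beta>\<^sup>2 / \<alpha> \<ge> 0"
    using assms(3,4) by (simp add: field_simps)
  ultimately show ?thesis
    using \<open>\<alpha> > 0\<close> by (simp only:) (intro sum_of_squares_add sum_of_squares_scale sum_of_squares_power2
        quadratic_form_add quadratic_form_scale p q; simp)
qed

lemma sum_of_squares_nonneg: "sum_of_squares f \<Longrightarrow> f x \<ge> 0"
  unfolding sum_of_squares_def by (metis sum_nonneg zero_le_power2)

section \<open>The common minimum of the SOS and PSD ranges\<close>

lemma SOS_imp_PSD: "SOS A \<Longrightarrow> PSD A"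
  unfolding SOS_iff_sum_of_squares PSD_def by (simp add: sum_of_squares_nonneg)

text \<open>Since SOS implies PSD, \<open>m\<close> lies in both sets and bounds both from
  below.\<close>

lemma PNS_free_if_least:
  assumes "SOS (param_tensor P m)" and "\<And>y. PSD (param_tensor P y) \<Longrightarrow> m \<le> y"
  shows "PNS_free P"
proof -
  have "M0 P = m" "N0 P = m"
    unfolding M0_def N0_def using assms by (auto intro!: Least_equality SOS_imp_PSD)
  then show ?thesis
    unfolding PNS_free_def has_least_def using assms SOS_imp_PSD by metis
qed

text \<open>The cubic equation is the stationarity condition \<open>q'(-T) = 0\<close>; the
  intermediate value theorem supplies a root large enough for the discriminant bound.\<close>

lemma cubic_root_exists:
  fixes \<rho> :: real
  assumes "\<rho> \<ge> 0"
  obtains T where "T \<ge> 869 / 100" "T^3 - 9 * T^2 + 3 * T - 3 = \<rho> * (3 * T - 1)"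
proof -
  let ?g = "\<lambda>T::real. T^3 - 9 * T^2 + 3 * T - 3 - \<rho> * (3 * T - 1)"
  have "?g (869/100) \<le> 0" using assms by (simp add: power2_eq_square power3_eq_cube)
  \<comment> \<open>At this endpoint \<open>T^3 - 9*T^2\<close> equals \<open>3*\<rho>*T^2\<close>,
    which dominates \<open>\<rho>*(3*T - 1)\<close>.\<close>
  moreover have "?g (9 + 3 * \<rho>) \<ge> 0"
  proof -
    have "?g (9 + 3 * \<rho>) = 27 * \<rho>^3 + 153 * \<rho>^2 + 226 * \<rho> + 24"
      by (simp add: algebra_simps power2_eq_square power3_eq_cube)
    then show ?thesis using assms by (metis add_nonneg_nonneg mult_nonneg_nonneg zero_le_numeral zero_le_power)
  qed
  moreover have "869/100 \<le> 9 + 3 * \<rho>" using assms by simp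
  moreover have "continuous_on {869/100..9 + 3 * \<rho>} ?g" by (intro continuous_intros)
  ultimately obtain T where "869/100 \<le> T" "?g T = 0"
    using IVT'[of ?g "869/100" 0 "9 + 3 * \<rho>"] by auto
  then show thesis using that by simp
qed

text \<open>In the Gram identity only the two binary forms need an argument; the other summands are
  nonnegative multiples of squares.\<close>

lemma SOS_param_tensor:
  fixes T \<tau> :: real
  assumes rel: "T^3 - 9 * T^2 + 3 * T - 3 = \<tau> * T^2 * (3 * T - 1)"
    and T: "T \<ge> 869 / 100"
  shows "SOS (param_tensor (- (\<tau> * T^2), 0, 0, 0, 0) (T^4 - 6 * T^3 - 2 * \<tau> * T^3 + 6 * T))"
proof -
  let ?v = "T^4 - 6 * T^3 - 2 * \<tau> * T^3 + 6 * T"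
  let ?A = "param_tensor (- (\<tau> * T^2), 0, 0, 0, 0) ?v"
  define k where "k = T^2 - 12 * T + 6 + 2 * \<tau> * T"
  \<comment> \<open>The relation makes \<open>\<tau>\<close> a rational function of \<open>T\<close>
    with limit \<open>1/3\<close> at infinity.\<close>
  have \<tau>: "\<tau> \<le> 1 / 3"
  proof -
    have "\<tau> * (T^2 * (3 * T - 1)) = 1 / 3 * (T^2 * (3 * T - 1)) - (T * (26 / 3 * T - 3) + 3)"
      using rel by (simp add: algebra_simps power2_eq_square power3_eq_cube)
    also have "\<dots> \<le> 1 / 3 * (T^2 * (3 * T - 1))"
    proof -
      have "T * (26 / 3 * T - 3) \<ge> 0" using T by simp
      then show ?thesis by linarith
    qed
    finally show ?thesis using T by (subst (asm) mult_le_cancel_right_pos) simp_all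
  qed
  have \<tau>T: "\<tau> * T \<le> T / 3" using \<tau> T by (simp add: mult_right_mono[of \<tau> "1/3" T, simplified])

  define a b c d :: "real^4 \<Rightarrow> real" where "a x = x $ of_nat 1" and "b x = x $ of_nat 2"
    and "c x = x $ of_nat 3" and "d x = x $ of_nat 4" for x
  note coord_defs = a_def b_def c_def d_def
  define X Y Z X' Y' Z' where "X x = (a x)^2 + (d x)^2" and "Y x = (b x)^2 + (c x)^2"
    and "Z x = a x * c x + b x * d x" and "X' x = (a x)^2 - (d x)^2" and "Y' x = (c x)^2 - (b x)^2"
    and "Z' x = a x * c x - b x * d x" for x
  define u w where "u x = T^2 * X x - Y x" and "w x = Y x + T * Z x" for x
  have qf: "quadratic_form (\<lambda>x. a x * c x)" "quadratic_form (\<lambda>x. b x * d x)"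
    "quadratic_form (\<lambda>x. a x * b x)" "quadratic_form (\<lambda>x. c x * d x)" "quadratic_form (\<lambda>x. a x * d x)"
    "quadratic_form (\<lambda>x. (a x)^2)" "quadratic_form (\<lambda>x. (b x)^2)"
    "quadratic_form (\<lambda>x. (c x)^2)" "quadratic_form (\<lambda>x. (d x)^2)"
    unfolding coord_defs power2_eq_square by (rule quadratic_form_coord_mult; simp)+
  note qf_intros = quadratic_form_add quadratic_form_diff quadratic_form_scale qf
  have forms: "quadratic_form u" "quadratic_form w" "quadratic_form X'" "quadratic_form Z'"
    "quadratic_form (\<lambda>x. Y' x + k * X' x - 6 * Z' x)"
    unfolding u_def w_def X_def Y_def Z_def X'_def Y'_def Z'_def by (intro qf_intros)+
  have S1: "sum_of_squares (\<lambda>x. ((T - 6) / 2 - \<tau>) * (u x)^2 + 2 * (- \<tau>) * u x * w x + (3 - \<tau>) * (w x)^2)"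
  proof (rule sum_of_squares_binary[OF forms(1,2)])
    \<comment> \<open>The squares of \<open>\<tau>\<close> cancel, so the determinant is linear in
      \<open>\<tau>\<close>.\<close>
    have "((T - 6) / 2 - \<tau>) * (3 - \<tau>) - (- \<tau>)\<^sup>2 = 3 * (T - 6) / 2 - \<tau> * T / 2"
      by (simp add: field_simps power2_eq_square)
    moreover have "3 * (T - 6) / 2 - \<tau> * T / 2 \<ge> 0"
    proof -
      have "\<tau> * T / 2 \<le> T / 6" using \<tau>T by (simp add: mult.commute)
      also have "\<dots> \<le> 3 * (T - 6) / 2" using T by simp
      finally show ?thesis by simp
    qed
    ultimately show "(- \<tau>)\<^sup>2 \<le> ((T - 6) / 2 - \<tau>) * (3 - \<tau>)"
      by (metis diff_ge_0_iff_ge)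
    show "(T - 6) / 2 - \<tau> > 0" using \<tau> T by simp
  qed
  \<comment> \<open>This is what remains of the block odd under reversal once the square of
    \<open>Y' + k*X' - 6*Z'\<close> is split off. Its determinant is the tight condition.\<close>
  have S2: "sum_of_squares (\<lambda>x. (6 * T - 36 - 2 * \<tau> * T) * (Z' x)^2
      + 2 * (6 * k - 2 * \<tau> * T^2) * Z' x * X' x + (?v + 6 * T - k^2) * (X' x)^2)"
  proof (rule sum_of_squares_binary[OF forms(4,3)])
    have "2 * \<tau> * T \<le> 2 * (T / 3)" using \<tau>T by (simp only: mult.assoc mult_le_cancel_left_pos)
    also have "\<dots> < 6 * T - 36" using T by simp
    finally show "6 * T - 36 - 2 * \<tau> * T > 0" by simp
    have v: "?v + 6 * T = T^4 - 6 * T^3 - 2 * \<tau> * T^3 + 12 * T" by simp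
    show "(6 * k - 2 * \<tau> * T^2)\<^sup>2 \<le> (6 * T - 36 - 2 * \<tau> * T) * (?v + 6 * T - k\<^sup>2)"
      unfolding k_def v by (simp only: discriminant_bound[OF rel T])
  qed
  have "sum_of_squares (\<lambda>x.
    (((T - 6) / 2 - \<tau>) * (u x)^2 + 2 * (- \<tau>) * u x * w x + (3 - \<tau>) * (w x)^2)
    + 3 * (a x * b x + c x * d x + 2 * T * (a x * d x))^2 + 3 * (a x * b x - c x * d x)^2
    + T / 2 * (Y' x + k * X' x - 6 * Z' x)^2
    + T / 2 * ((6 * T - 36 - 2 * \<tau> * T) * (Z' x)^2 + 2 * (6 * k - 2 * \<tau> * T^2) * Z' x * X' x
        + (?v + 6 * T - k^2) * (X' x)^2))" (is "sum_of_squares ?g")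
    using T by (intro sum_of_squares_add[OF sum_of_squares_add[OF sum_of_squares_add[OF
          sum_of_squares_add[OF S1]]]] sum_of_squares_scale[OF sum_of_squares_power2]
          sum_of_squares_scale[OF S2] sum_of_squares_power2 forms qf_intros) simp_all
  then have "sum_of_squares (\<lambda>x. 1 / T * ?g x)"
    using T by (intro sum_of_squares_scale) auto
  moreover have "1 / T * ?g x = tensor_poly ?A x" for x
  proof -
    have "T * tensor_poly ?A x = ?g x"
      unfolding tensor_poly_param[OF a_def b_def c_def d_def]
        u_def w_def X_def Y_def Z_def X'_def Y'_def Z'_def k_def
      by (rule gram_decomposition[OF rel])
    then show ?thesis using T by (simp add: field_simps)
  qed
  ultimately show ?thesis by (simp add: SOS_iff_sum_of_squares)
qed

lemma PSD_param_tensor_bound: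
  fixes T \<tau> :: real
  assumes rel: "T^3 - 9 * T^2 + 3 * T - 3 = \<tau> * T^2 * (3 * T - 1)"
    and psd: "PSD (param_tensor (- (\<tau> * T^2), 0, 0, 0, 0) y)"
  shows "T^4 - 6 * T^3 - 2 * \<tau> * T^3 + 6 * T \<le> y"
proof -
  define z :: "real^4" where "z = (\<chi> i. if i = 1 \<or> i = 4 then 1 else - T)"
  have z: "1 = z $ of_nat 1" "- T = z $ of_nat 2" "- T = z $ of_nat 3" "1 = z $ of_nat 4"
    by (simp_all add: z_def)
  \<comment> \<open>At the zero \<open>(1, -T, -T, 1)\<close> the value is twice the gap to the
    claimed bound, up to a multiple of the cubic relation.\<close>
  have "tensor_poly (param_tensor (- (\<tau> * T^2), 0, 0, 0, 0) y) z =
      2 * (y - (T^4 - 6 * T^3 - 2 * \<tau> * T^3 + 6 * T))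
      + 4 * T * (T^3 - 9 * T^2 + 3 * T - 3 - \<tau> * T^2 * (3 * T - 1))"
    unfolding tensor_poly_param[OF z]
    by (simp add: algebra_simps power2_eq_square power3_eq_cube power4_eq_xxxx)
  also have "\<dots> = 2 * (y - (T^4 - 6 * T^3 - 2 * \<tau> * T^3 + 6 * T))"
    using rel by simp
  finally have "0 \<le> 2 * (y - (T^4 - 6 * T^3 - 2 * \<tau> * T^3 + 6 * T))"
    using psd[unfolded PSD_def, rule_format, of z] by (simp only:)
  then show ?thesis by simp
qed

theorem theorem9:
  fixes \<rho> :: real
  assumes "\<rho> \<ge> 0"
  shows "PNS_free (- \<rho>, 0, 0, 0, 0)"
proof -
  obtain T where T: "T \<ge> 869 / 100" and root: "T^3 - 9 * T^2 + 3 * T - 3 = \<rho> * (3 * T - 1)"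
    using cubic_root_exists[OF assms] .
  \<comment> \<open>This scaling keeps \<open>\<tau>\<close> bounded as \<open>\<rho>\<close>
    grows.\<close>
  define \<tau> where "\<tau> = \<rho> / T^2"
  have \<rho>: "\<rho> = \<tau> * T^2" using T by (simp add: \<tau>_def)
  show ?thesis
    using SOS_param_tensor[OF root[unfolded \<rho>] T] PSD_param_tensor_bound[OF root[unfolded \<rho>]]
    unfolding \<rho> by (rule PNS_free_if_least)
qed

end
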